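(* Let $L$ be a finite lattice. Then a subset $X\subseteq L$ is a distributive ideal if and only if it is a downset of join-irreducible elements of $L$. In other words, $\mathsf{BL}(L)=\mathcal{O}\mathcal{J}(L)$.
   Context: For a poset $P$, a subset $A\subseteq P$ is a downset if for all $x,y\in P$ with $y\le x$ and $x\in A$ one has $y\in A$; $\mathcal O(P)$ denotes the set of downsets of $P$, partially ordered by inclusion. For a finite lattice $L$ with bottom element $\bot$, an element $x\in L$ is join-irreducible if $x\neq\bot$ and whenever $a\vee b=x$ then $a=x$ or $b=x$; $\mathcal J(L)$ denotes the subposet of join-irreducible elements of $L$, and $\mathcal{O}\mathcal{J}(L)=\mathcal O(\mathcal J(L))$, so that a downset of join-irreducible elements of $L$ means an element of $\mathcal{O}\mathcal{J}(L)$. A subset $S$ of a meet-semilattice $L$ is distributive if for every $x\in L$ the following joins exist and $x\wedge\bigvee S=\bigvee\{x\wedge s : s\in S\}$ (in a finite lattice the existence of the joins is automatic). A distributive ideal in a meet-semilattice $L$ is a subset $A\subseteq L$ such that (1) $A$ is a downset of $L$, and (2) if $I\subseteq A$ and $I$ is a distributive subset of $L$, then $\bigvee I\in A$. $\mathsf{BL}(L)$, the Bruns-Lakser completion of $L$, is the subposet of the power set of $L$ consisting of the distributive ideals, ordered by inclusion.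
   Formalization: Every distributive ideal contains ⊥, so the literal equality BL(L) = OJ(L) fails; it is proved as an order isomorphism, X ↦ X ∩ J(L), with inverse sending D to the set of x all of whose join-irreducible lower bounds lie in D. *)

theory Defs
  imports Main "HOL-Library.Lub_Glb"
begin

definition downsets :: "'a::order set \<Rightarrow> 'a set set" where
  "downsets P = {A. A \<subseteq> P \<and> (\<forall>x\<in>A. \<forall>y\<in>P. y \<le> x \<longrightarrow> y \<in> A)}"

text \<open>A finite lattice has a bottom element even when its type carries no constant for it:
  it is \<open>Inf_fin UNIV\<close>.\<close>

definition join_irreducibles :: "'a::{finite,lattice} set" where
  "join_irreducibles =
    {x. x \<noteq> Inf_fin UNIV \<and> (\<forall>a b. sup a b = x \<longrightarrow> a = x \<or> b = x)}"

text \<open>In a meet-semilattice joins need not exist; \<open>isLub UNIV S j\<close> says that the join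
  of \<open>S\<close> exists and equals \<open>j\<close>. The empty set is allowed.\<close>

definition distributive_set :: "'a::semilattice_inf set \<Rightarrow> bool" where
  "distributive_set S \<longleftrightarrow>
    (\<exists>j. isLub UNIV S j \<and> (\<forall>x. isLub UNIV ((\<lambda>s. inf x s) ` S) (inf x j)))"

definition distributive_ideal :: "'a::semilattice_inf set \<Rightarrow> bool" where
  "distributive_ideal A \<longleftrightarrow> A \<in> downsets UNIV \<and>
    (\<forall>I j. I \<subseteq> A \<longrightarrow> distributive_set I \<longrightarrow> isLub UNIV I j \<longrightarrow> j \<in> A)"

definition BL :: "'a::semilattice_inf set set" where
  "BL = {A. distributive_ideal A}"

definition OJ :: "'a::{finite,lattice} set set" where
  "OJ = downsets join_irreducibles"

text \<open>A distributive ideal contains the bottom element (the join of the distributive set \<open>{}\<close>),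
  and may contain further elements that are not join-irreducible, so it is never literally a set
  of join-irreducible elements. A downset \<open>D\<close> of join-irreducible elements is identified with the
  set of those elements of the lattice all of whose join-irreducible lower bounds lie in \<open>D\<close>;
  conversely \<open>D\<close> is recovered as the set of join-irreducible elements of that set.\<close>

definition downset_extension :: "'a::{finite,lattice} set \<Rightarrow> 'a set" where
  "downset_extension D = {x. \<forall>p\<in>join_irreducibles. p \<le> x \<longrightarrow> p \<in> D}"

definition order_iso_on :: "('a::order \<Rightarrow> 'b::order) \<Rightarrow> 'a set \<Rightarrow> 'b set \<Rightarrow> bool" where
  "order_iso_on f A B \<longleftrightarrow>
    bij_betw f A B \<and> (\<forall>x\<in>A. \<forall>y\<in>A. f x \<le> f y \<longleftrightarrow> x \<le> y)"

end

theory Submission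
  imports Defs
begin

text \<open>
  Two properties of the join-irreducible elements of a finite lattice carry the proof. They are
  join-dense: every \<open>x\<close> is the join of the set \<open>J\<^sub>x\<close> of join-irreducibles below it
  (\<open>isLub_join_irreducibles_below\<close>). And a join-irreducible that is a join of some set belongs to
  that set (\<open>join_irreducible_in_set_if_isLub\<close>).

  Density makes \<open>J\<^sub>x\<close> a distributive set, in any finite lattice: among the meets \<open>inf y p\<close> with
  \<open>p \<in> J\<^sub>x\<close> are all join-irreducibles below \<open>inf y x\<close>, so by density
  every upper bound of these meets lies above \<open>inf y x\<close>.
  A distributive ideal containing \<open>J\<^sub>x\<close> therefore contains \<open>x\<close>, that is, a distributive ideal is
  determined by its join-irreducible elements (\<open>downset_extension_inverse\<close>).

  Conversely, let \<open>D\<close> be a downset of join-irreducibles and let \<open>j\<close> be the join of a distributive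
  set \<open>I\<close> of elements whose join-irreducible lower bounds all lie in \<open>D\<close>. For a join-irreducible
  \<open>p \<le> j\<close>, distributivity writes \<open>p = inf p j\<close> as the join of the meets \<open>inf p s\<close> with \<open>s \<in> I\<close>, so
  \<open>p = inf p s\<close> for one of them; then \<open>p \<le> s\<close> and \<open>p \<in> D\<close>
  (\<open>distributive_ideal_downset_extension\<close>). Distributivity of \<open>I\<close> thus substitutes for
  distributivity of the lattice, in which a join-irreducible would be join-prime.

  The two passages are monotone and mutually inverse, hence order isomorphisms.
\<close>

lemma isLub_UNIV_iff:
  fixes j :: "'a::order"
  shows "isLub UNIV S j \<longleftrightarrow> (\<forall>s\<in>S. s \<le> j) \<and> (\<forall>u. (\<forall>s\<in>S. s \<le> u) \<longrightarrow> j \<le> u)"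
  by (auto simp: isLub_def leastP_def isUb_def setle_def setge_def)

lemma order_iso_on_if_mono_inverse:
  assumes "\<And>x. x \<in> A \<Longrightarrow> f x \<in> B" and "\<And>y. y \<in> B \<Longrightarrow> g y \<in> A"
    and gf: "\<And>x. x \<in> A \<Longrightarrow> g (f x) = x" and "\<And>y. y \<in> B \<Longrightarrow> f (g y) = y"
    and "mono f" and "mono g"
  shows "order_iso_on f A B"
proof -
  have "bij_betw f A B"
    using assms by (intro bij_betw_byWitness[where f' = g]) auto
  moreover have "f x \<le> f y \<longleftrightarrow> x \<le> y" if "x \<in> A" "y \<in> A" for x y
    using that gf monoD[OF \<open>mono f\<close>, of x y] monoD[OF \<open>mono g\<close>, of "f x" "f y"] by auto
  ultimately show ?thesis
    by (auto simp: order_iso_on_def)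
qed

section \<open>Join-irreducible elements of a finite lattice\<close>

text \<open>An element that is neither the bottom nor join-irreducible is the join of two strictly
  smaller ones, so the claim follows by induction along the strict order, which is well-founded
  by finiteness.\<close>

lemma le_if_join_irreducibles_le:
  fixes x :: "'a::{finite,lattice}"
  assumes "\<And>p. p \<in> join_irreducibles \<Longrightarrow> p \<le> x \<Longrightarrow> p \<le> u"
  shows "x \<le> u"
  using assms
proof (induction "card {y. y < x}" arbitrary: x rule: less_induct)
  case less
  have smaller: "y \<le> u" if "y < x" for y
  proof (rule less.hyps)
    have "{z. z < y} \<subset> {z. z < x}"
      using that by (auto dest: less_trans)
    then show "card {z. z < y} < card {z. z < x}"
      by (simp add: psubset_card_mono)
  qed (use less.prems that in \<open>auto intro: order_trans\<close>)
  consider "x = Inf_fin UNIV" | "x \<in> join_irreducibles"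
    | a b where "sup a b = x" "a \<noteq> x" "b \<noteq> x"
    by (auto simp: join_irreducibles_def)
  then show ?case
  proof cases
    case 1
    then show ?thesis by (simp add: Inf_fin.coboundedI)
  next
    case 2
    then show ?thesis using less.prems by simp
  next
    case 3
    then have "a < x" "b < x" by (auto simp: less_le)
    then have "sup a b \<le> u" using smaller by simp
    then show ?thesis using 3 by simp
  qed
qed

lemma isLub_join_irreducibles_below:
  fixes x :: "'a::{finite,lattice}"
  shows "isLub UNIV {p \<in> join_irreducibles. p \<le> x} x"
  by (auto simp: isLub_UNIV_iff intro: le_if_join_irreducibles_le)

text \<open>Irreducibility concerns binary joins. Splitting off one element of \<open>S\<close> at a time extends it
  to finite nonempty ones: the join is either the element split off or the join of the rest.\<close>

lemma join_irreducible_Sup_fin_in_set: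
  fixes S :: "'a::{finite,lattice} set"
  assumes "S \<noteq> {}" and "Sup_fin S \<in> join_irreducibles"
  shows "Sup_fin S \<in> S"
  using finite[of S] assms
proof (induction S rule: finite_ne_induct)
  case (insert x F)
  then have sup: "Sup_fin (insert x F) = sup x (Sup_fin F)"
    by simp
  then consider "Sup_fin (insert x F) = x" | "Sup_fin (insert x F) = Sup_fin F"
    using insert.prems unfolding join_irreducibles_def mem_Collect_eq by metis
  then show ?case
    using insert by cases auto
qed simp

lemma join_irreducible_in_set_if_isLub:
  fixes p :: "'a::{finite,lattice}"
  assumes p: "p \<in> join_irreducibles" and lub: "isLub UNIV S p"
  shows "p \<in> S"
proof -
  \<comment> \<open>The join of the empty set is the bottom, which is not join-irreducible.\<close>
  have "S \<noteq> {}"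
  proof
    assume "S = {}"
    then have "p \<le> Inf_fin UNIV"
      using lub by (simp add: isLub_UNIV_iff)
    then have "p = Inf_fin UNIV"
      by (simp add: Inf_fin.coboundedI antisym)
    then show False
      using p by (simp add: join_irreducibles_def)
  qed
  moreover from this have "Sup_fin S = p"
    using lub by (intro antisym) (auto simp: isLub_UNIV_iff Sup_fin.coboundedI intro: Sup_fin.boundedI)
  ultimately show ?thesis
    using join_irreducible_Sup_fin_in_set p by blast
qed

section \<open>Distributive ideals and downsets of join-irreducibles\<close>

text \<open>By density it suffices to bound the join-irreducibles \<open>p \<le> inf y x\<close>. Each of them is itself
  one of the meets, namely \<open>inf y p\<close>.\<close>

lemma distributive_set_join_irreducibles_below:
  fixes x :: "'a::{finite,lattice}"
  shows "distributive_set {p \<in> join_irreducibles. p \<le> x}"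
proof -
  let ?J = "{p \<in> join_irreducibles. p \<le> x}"
  have "isLub UNIV (inf y ` ?J) (inf y x)" for y
    unfolding isLub_UNIV_iff
  proof (intro conjI allI impI)
    show "\<forall>s\<in>inf y ` ?J. s \<le> inf y x"
      by (auto intro: le_infI2)
  next
    fix u assume u: "\<forall>s\<in>inf y ` ?J. s \<le> u"
    show "inf y x \<le> u"
    proof (rule le_if_join_irreducibles_le)
      fix p :: 'a
      assume "p \<in> join_irreducibles" and "p \<le> inf y x"
      then have "p \<in> ?J" and "inf y p = p"
        by (auto simp: inf_absorb2)
      then show "p \<le> u" using u by force
    qed
  qed
  then show ?thesis
    unfolding distributive_set_def using isLub_join_irreducibles_below by blast
qed

text \<open>Whatever \<open>D\<close> is, the join-irreducibles below the join of a distributive set \<open>I\<close> are those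
  below some element of \<open>I\<close>: testing the distributivity of \<open>I\<close> against \<open>p\<close> itself turns \<open>p\<close> into a
  join of meets, to which irreducibility applies.\<close>

lemma distributive_ideal_downset_extension:
  fixes D :: "'a::{finite,lattice} set"
  shows "distributive_ideal (downset_extension D)"
  unfolding distributive_ideal_def
proof (intro conjI allI impI)
  show "downset_extension D \<in> downsets UNIV"
    by (auto simp: downsets_def downset_extension_def intro: order_trans)
next
  fix I :: "'a set" and j
  assume I: "I \<subseteq> downset_extension D" and dist: "distributive_set I" and lub: "isLub UNIV I j"
  \<comment> \<open>Distributivity of \<open>I\<close> speaks of some join of \<open>I\<close>; it is \<open>j\<close> since joins are unique.\<close>
  obtain j' where "isLub UNIV I j'" and meets: "\<And>x. isLub UNIV (inf x ` I) (inf x j')"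
    using dist by (auto simp: distributive_set_def)
  then have [simp]: "j' = j"
    using lub by (intro antisym) (auto simp: isLub_UNIV_iff)
  show "j \<in> downset_extension D"
    unfolding downset_extension_def
  proof (intro CollectI ballI impI)
    fix p :: 'a
    assume p: "p \<in> join_irreducibles" and "p \<le> j"
    then have "isLub UNIV (inf p ` I) p"
      using meets[of p] by (simp add: inf_absorb1)
    then have "p \<in> inf p ` I"
      by (rule join_irreducible_in_set_if_isLub[OF p])
    then obtain s where "s \<in> I" and "p \<le> s"
      by (metis imageE inf.orderI)
    then show "p \<in> D"
      using I p by (auto simp: downset_extension_def)
  qed
qed

lemma distributive_ideal_Int_join_irreducibles:
  assumes "distributive_ideal A"
  shows "A \<inter> join_irreducibles \<in> OJ"
  using assms by (auto simp: distributive_ideal_def OJ_def downsets_def)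

text \<open>For the inclusion into \<open>A\<close>, closure under distributive joins is applied to a single
  distributive set, the join-irreducibles below the given element.\<close>

lemma downset_extension_inverse:
  fixes A :: "'a::{finite,lattice} set"
  assumes A: "distributive_ideal A"
  shows "downset_extension (A \<inter> join_irreducibles) = A"
proof
  show "A \<subseteq> downset_extension (A \<inter> join_irreducibles)"
    using A by (auto simp: downset_extension_def distributive_ideal_def downsets_def)
next
  show "downset_extension (A \<inter> join_irreducibles) \<subseteq> A"
  proof
    fix x assume "x \<in> downset_extension (A \<inter> join_irreducibles)"
    then have "{p \<in> join_irreducibles. p \<le> x} \<subseteq> A"
      by (auto simp: downset_extension_def)
    then show "x \<in> A"
      using A distributive_set_join_irreducibles_below isLub_join_irreducibles_below
      unfolding distributive_ideal_def by blast
  qed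
qed

lemma downset_extension_Int_join_irreducibles:
  assumes "D \<in> OJ"
  shows "downset_extension D \<inter> join_irreducibles = D"
  using assms by (auto simp: OJ_def downsets_def downset_extension_def)

lemma mono_downset_extension: "mono downset_extension"
  by (auto simp: mono_def downset_extension_def)

theorem proposition7p23:
  fixes X :: "'a::{finite,lattice} set"
  shows "(distributive_ideal X \<longleftrightarrow>
            (\<exists>D\<in>OJ. X = downset_extension D \<and> D = X \<inter> join_irreducibles))
    \<and> order_iso_on (\<lambda>A. A \<inter> join_irreducibles) (BL :: 'a set set) OJ
    \<and> order_iso_on downset_extension OJ (BL :: 'a set set)"
proof (intro conjI)
  show "distributive_ideal X \<longleftrightarrow>
      (\<exists>D\<in>OJ. X = downset_extension D \<and> D = X \<inter> join_irreducibles)"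
    using distributive_ideal_downset_extension distributive_ideal_Int_join_irreducibles
      downset_extension_inverse by metis
  have mono_Int: "mono (\<lambda>A::'a set. A \<inter> join_irreducibles)"
    by (auto simp: mono_def)
  note facts = mono_Int mono_downset_extension distributive_ideal_downset_extension
    distributive_ideal_Int_join_irreducibles downset_extension_inverse
    downset_extension_Int_join_irreducibles
  show "order_iso_on (\<lambda>A. A \<inter> join_irreducibles) (BL :: 'a set set) OJ"
    by (rule order_iso_on_if_mono_inverse[where g = downset_extension])
      (simp_all add: BL_def facts)
  show "order_iso_on downset_extension OJ (BL :: 'a set set)"
    by (rule order_iso_on_if_mono_inverse[where g = "\<lambda>A. A \<inter> join_irreducibles"])
      (simp_all add: BL_def facts)
qed

end
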